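(* Let $k,n$ be positive integers with $n\ge 400$ and $\lfloor n/5\rfloor\le k\le \lfloor n/2\rfloor$. Then $$\binom nk<e^{-(k-\lfloor n/5\rfloor)\frac {11}{12n^2}} \frac{n^{n-\frac 12}}{k^k(n-k)^{n-k}}<\Big(1-\frac{5(k-\lfloor n/5\rfloor)}{6n^2}\Big) \frac{n^{n-\frac 12}}{k^k(n-k)^{n-k}} <\Big(1-\frac{5(k-\lfloor n/5\rfloor)}{6n^2}\Big)\frac{2^n}{\sqrt n}.$$
   Context: $\lfloor x\rfloor$ denotes the greatest integer not exceeding $x$.
   Formalization: The second inequality is an equality when k = ⌊n/5⌋, and the third is an equality when k = n/2, so these two are stated as ≤ in general and as strict whenever k ≠ ⌊n/5⌋, respectively k ≠ n/2; the first inequality is strict throughout. *)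

theory Defs
  imports Complex_Main
begin

end

theory Submission
  imports Defs "HOL-Analysis.Gamma_Function"
begin

text \<open>
  Put \<open>F k = ln (n choose k) - ln M + 11 d / (12 n\<^sup>2)\<close>, where \<open>M\<close> and \<open>d\<close> are as in the theorem; the
  first inequality says \<open>F k < 0\<close>. Passing from \<open>k\<close> to \<open>k + 1\<close> changes \<open>ln (n choose k) - ln M\<close> by
  \<open>k ln (1 + 1/k) - m ln (1 + 1/m)\<close> with \<open>m = n - k - 1 > k\<close>, which is at most
  \<open>- 11 / (12 n\<^sup>2)\<close>, so \<open>F\<close> is decreasing and only \<open>k = \<lfloor>n/5\<rfloor>\<close> matters. There Robbins' form of
  Stirling's formula, with the constant \<open>sqrt (2 \<pi>)\<close> obtained from Wallis' product, reduces the claim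
  to a polynomial inequality in \<open>k\<close> for each residue of \<open>n\<close> modulo 5. The case \<open>n = 404\<close> is
  nearly sharp (\<open>F k\<close> is about \<open>- 1.3 / 10\<^sup>6\<close>), which is why both \<open>\<pi>\<close> and the Stirling
  remainders are needed to high precision.
\<close>

section \<open>Rational bounds for the logarithm\<close>

text \<open>The left side is the start of the series 2 artanh t = 2 (t + t^3/3 + t^5/5 + ...), whose
  terms are nonnegative. The proof checks the sign of the derivative of the difference instead of
  using the series.\<close>

lemma ln_artanh_lower:
  fixes t :: real
  assumes "0 \<le> t" "t < 1"
  shows "2 * t + 2 * t ^ 3 / 3 \<le> ln ((1 + t) / (1 - t))"
proof -
  let ?f = "\<lambda>t::real. ln (1 + t) - ln (1 - t) - (2 * t + 2 * t ^ 3 / 3)"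
  have "?f 0 \<le> ?f t"
  proof (rule DERIV_nonneg_imp_nondecreasing[OF assms(1)])
    fix x :: real assume x: "0 \<le> x" "x \<le> t"
    then have x1: "x < 1" using assms by simp
    have "x ^ 2 < 1" using x x1 by (simp add: power_less_one_iff abs_square_less_1)
    have "(?f has_real_derivative (1 / (1 + x) + 1 / (1 - x) - (2 + 2 * x ^ 2))) (at x)"
      using x x1 by (auto intro!: derivative_eq_intros)
    also have "1 / (1 + x) + 1 / (1 - x) - (2 + 2 * x ^ 2) = 2 * x ^ 4 / (1 - x ^ 2)"
      using x x1 \<open>x ^ 2 < 1\<close> by (simp add: divide_simps) algebra
    finally have "(?f has_real_derivative 2 * x ^ 4 / (1 - x ^ 2)) (at x)" .
    moreover have "0 \<le> 2 * x ^ 4 / (1 - x ^ 2)"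
      using \<open>x ^ 2 < 1\<close> by simp
    ultimately show "\<exists>y. (?f has_real_derivative y) (at x) \<and> 0 \<le> y" by (intro exI conjI)
  qed
  then show ?thesis using assms by (simp add: ln_div)
qed

text \<open>From t^3 on, the artanh series is dominated by the geometric series (t^3/3) (1 + t^2 +
  t^4 + ...).\<close>

lemma ln_artanh_upper:
  fixes t :: real
  assumes "0 \<le> t" "t < 1"
  shows "ln ((1 + t) / (1 - t)) \<le> 2 * t + 2 * t ^ 3 / (3 * (1 - t ^ 2))"
proof -
  let ?f = "\<lambda>t::real. 2 * t + 2 * t ^ 3 / (3 * (1 - t ^ 2)) - (ln (1 + t) - ln (1 - t))"
  have "?f 0 \<le> ?f t"
  proof (rule DERIV_nonneg_imp_nondecreasing[OF assms(1)])
    fix x :: real assume x: "0 \<le> x" "x \<le> t"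
    then have x1: "x < 1" using assms by simp
    have x2: "x ^ 2 < 1" using x x1 by (simp add: power_less_one_iff abs_square_less_1)
    have "(?f has_real_derivative (2 + (6 * x ^ 2 * (3 * (1 - x ^ 2)) + 2 * x ^ 3 * (6 * x))
            / (3 * (1 - x ^ 2)) ^ 2 - (1 / (1 + x) + 1 / (1 - x)))) (at x)"
      using x x1 x2 by (auto intro!: derivative_eq_intros simp: power2_eq_square)
    also have "2 + (6 * x ^ 2 * (3 * (1 - x ^ 2)) + 2 * x ^ 3 * (6 * x))
            / (3 * (1 - x ^ 2)) ^ 2 - (1 / (1 + x) + 1 / (1 - x)) = 4 * x ^ 4 / (3 * (1 - x ^ 2) ^ 2)"
      using x x1 x2 by (simp add: divide_simps) algebra
    finally have "(?f has_real_derivative 4 * x ^ 4 / (3 * (1 - x ^ 2) ^ 2)) (at x)" .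
    moreover have "0 \<le> 4 * x ^ 4 / (3 * (1 - x ^ 2) ^ 2)" by simp
    ultimately show "\<exists>y. (?f has_real_derivative y) (at x) \<and> 0 \<le> y" by (intro exI conjI)
  qed
  then show ?thesis using assms by (simp add: ln_div)
qed

text \<open>Both bounds come from \<open>1 + 1/x = (1 + t) / (1 - t)\<close> with \<open>t = 1 / (2 x + 1)\<close>.\<close>

lemma ln_one_plus_inverse_bounds:
  fixes x :: real
  assumes "0 < x"
  shows ln_one_plus_inverse_lower:
      "2 / (2 * x + 1) + 2 / (3 * (2 * x + 1) ^ 3) \<le> ln (1 + 1 / x)"
    and ln_one_plus_inverse_upper:
      "ln (1 + 1 / x) \<le> 2 / (2 * x + 1) + 1 / (6 * x * (x + 1) * (2 * x + 1))"
proof -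
  define t where "t = 1 / (2 * x + 1)"
  have t: "0 \<le> t" "t < 1" using assms by (auto simp: t_def)
  have e: "(1 + t) / (1 - t) = 1 + 1 / x"
    using assms by (simp add: t_def divide_simps)
  have "1 - t ^ 2 = 4 * x * (x + 1) / (2 * x + 1) ^ 2"
    using assms by (simp add: t_def power_divide divide_simps) algebra
  then have "2 * t ^ 3 / (3 * (1 - t ^ 2)) = 1 / (6 * x * (x + 1) * (2 * x + 1))"
    using assms by (simp add: t_def power_divide divide_simps power2_eq_square power3_eq_cube)
  then show "ln (1 + 1 / x) \<le> 2 / (2 * x + 1) + 1 / (6 * x * (x + 1) * (2 * x + 1))"
    using ln_artanh_upper[OF t] e by (simp add: t_def)
  show "2 / (2 * x + 1) + 2 / (3 * (2 * x + 1) ^ 3) \<le> ln (1 + 1 / x)"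
    using ln_artanh_lower[OF t] e by (simp add: t_def power_divide)
qed

section \<open>Robbins' bounds for the Stirling remainder\<close>

definition stirling_rem :: "nat \<Rightarrow> real" where
  "stirling_rem n = ln (fact n) - (real n + 1 / 2) * ln (real n) + real n"

lemma stirling_rem_diff:
  assumes "0 < n"
  shows "stirling_rem n - stirling_rem (Suc n) = (real n + 1 / 2) * ln (1 + 1 / real n) - 1"
proof -
  have "1 + 1 / real n = real (Suc n) / real n"
    using assms by (simp add: field_simps)
  then have "ln (1 + 1 / real n) = ln (real (Suc n)) - ln (real n)"
    using assms by (simp add: ln_div)
  moreover have "ln (fact (Suc n) :: real) = ln (real (Suc n)) + ln (fact n)"
    unfolding fact_Suc by (subst ln_mult) auto
  ultimately show ?thesis
    unfolding stirling_rem_def by (simp only: of_nat_Suc) (simp add: field_simps)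
qed

text \<open>Multiplied by n + 1/2, the upper bound for ln (1 + 1/n) becomes exactly 1 + 1/(12 n
  (n+1)), whose excess over 1 telescopes.\<close>

lemma stirling_rem_diff_upper:
  assumes "0 < n"
  shows "stirling_rem n - stirling_rem (Suc n) \<le> 1 / (12 * real n) - 1 / (12 * real (Suc n))"
proof -
  have "(real n + 1 / 2) * ln (1 + 1 / real n)
      \<le> (real n + 1 / 2) * (2 / (2 * real n + 1) + 1 / (6 * real n * (real n + 1) * (2 * real n + 1)))"
    using ln_one_plus_inverse_upper[of "real n"] assms by (intro mult_left_mono) auto
  also have "\<dots> = 1 + (1 / (12 * real n) - 1 / (12 * real (Suc n)))"
    using assms by (simp add: divide_simps) algebra
  finally show ?thesis using stirling_rem_diff[OF assms] by simp
qed

lemma stirling_rem_diff_lower: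
  assumes "0 < n"
  shows "1 / (12 * real n + 1) - 1 / (12 * real (Suc n) + 1) \<le> stirling_rem n - stirling_rem (Suc n)"
proof -
  have n: "real n \<ge> 1" using assms by simp
  have "1 / (12 * real n + 1) - 1 / (12 * real (Suc n) + 1)
      = 12 / ((12 * real n + 1) * (12 * real n + 13))"
    by (simp add: divide_simps)
  also have "\<dots> \<le> 1 / (3 * (2 * real n + 1) ^ 2)"
  proof -
    \<comment> \<open>The right side exceeds the left by 24 n - 23.\<close>
    have "12 * (3 * (2 * real n + 1) ^ 2) \<le> (12 * real n + 1) * (12 * real n + 13)"
      using n by (simp add: power2_eq_square algebra_simps)
    moreover have "0 < 3 * (2 * real n + 1) ^ 2" "0 < (12 * real n + 1) * (12 * real n + 13)"
      using n by (auto intro!: mult_pos_pos)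
    ultimately show ?thesis by (simp add: pos_divide_le_eq pos_le_divide_eq mult.commute)
  qed
  also have "\<dots> = (real n + 1 / 2) * (2 / (2 * real n + 1) + 2 / (3 * (2 * real n + 1) ^ 3)) - 1"
  proof -
    define a where "a = 2 * real n + 1"
    have a: "a > 0" "real n + 1 / 2 = a / 2" by (auto simp: a_def)
    show ?thesis unfolding a(2) a_def[symmetric]
      using a(1) by (simp add: field_simps power2_eq_square power3_eq_cube)
  qed
  also have "\<dots> \<le> (real n + 1 / 2) * ln (1 + 1 / real n) - 1"
    using ln_one_plus_inverse_lower[of "real n"] assms
    by (intro diff_right_mono mult_left_mono) auto
  finally show ?thesis using stirling_rem_diff[OF assms] by simp
qed

lemma wallis_prod_eq_fact:
  "(\<Prod>k=1..n. (4 * real k ^ 2) / (4 * real k ^ 2 - 1))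
     = 2 ^ (4 * n) * fact n ^ 4 / (fact (2 * n) ^ 2 * (2 * real n + 1))"
proof (induction n)
  case (Suc n)
  define f g :: real where "f = fact n" and "g = fact (2 * n)"
  have fs: "fact (Suc n) = (real n + 1) * f" "fact (2 * Suc n) = (2 * real n + 2) * (2 * real n + 1) * g"
    by (simp_all add: f_def g_def algebra_simps)
  have [simp]: "f > 0" "g > 0" by (simp_all add: f_def g_def)
  have d: "4 * real (Suc n) ^ 2 - 1 = (2 * real n + 1) * (2 * real n + 3)"
    by (simp add: power2_eq_square algebra_simps)
  have "(\<Prod>k=1..Suc n. (4 * real k ^ 2) / (4 * real k ^ 2 - 1))
     = 2 ^ (4 * n) * f ^ 4 / (g ^ 2 * (2 * real n + 1))
       * (4 * (real n + 1) ^ 2 / ((2 * real n + 1) * (2 * real n + 3)))"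
    using Suc d by (simp add: f_def g_def add.commute)
  also have "\<dots> = 2 ^ (4 * Suc n) * ((real n + 1) * f) ^ 4
       / (((2 * real n + 2) * (2 * real n + 1) * g) ^ 2 * (2 * real (Suc n) + 1))"
    by (simp add: divide_simps power_add) algebra
  finally show ?case unfolding fs .
qed simp

text \<open>In 4 \<open>stirling_rem n\<close> - 2 \<open>stirling_rem (2 * n)\<close> the linear
  terms cancel, and so do the multiples of n ln n.\<close>

lemma ln_wallis_prod:
  assumes "0 < n"
  shows "ln (\<Prod>k=1..n. (4 * real k ^ 2) / (4 * real k ^ 2 - 1))
    = 4 * stirling_rem n - 2 * stirling_rem (2 * n) - ln 2 - ln (2 + 1 / real n)"
proof -
  have "2 + 1 / real n = (2 * real n + 1) / real n"
    using assms by (simp add: field_simps)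
  then have "ln (2 + 1 / real n) = ln (2 * real n + 1) - ln (real n)"
    using assms by (simp add: ln_div)
  moreover have "ln (2 * real n) = ln 2 + ln (real n)"
    using assms by (simp add: ln_mult)
  moreover have "ln (2 ^ (4 * n) * fact n ^ 4 / (fact (2 * n) ^ 2 * (2 * real n + 1)))
      = 4 * real n * ln 2 + 4 * ln (fact n) - 2 * ln (fact (2 * n)) - ln (2 * real n + 1)"
    by (simp add: ln_mult ln_div ln_realpow)
  ultimately show ?thesis
    unfolding wallis_prod_eq_fact stirling_rem_def by (simp add: algebra_simps)
qed

text \<open>The index is shifted by one because the difference bounds are available only for
  positive arguments.\<close>

lemma stirling_rem_minus_incseq: "incseq (\<lambda>n. stirling_rem (Suc n) - 1 / (12 * real (Suc n)))"
proof (rule incseq_SucI)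
  show "stirling_rem (Suc n) - 1 / (12 * real (Suc n))
      \<le> stirling_rem (Suc (Suc n)) - 1 / (12 * real (Suc (Suc n)))" for n
    using stirling_rem_diff_upper[of "Suc n"] by linarith
qed

lemma stirling_rem_minus_decseq: "decseq (\<lambda>n. stirling_rem (Suc n) - 1 / (12 * real (Suc n) + 1))"
proof (rule decseq_SucI)
  show "stirling_rem (Suc (Suc n)) - 1 / (12 * real (Suc (Suc n)) + 1)
      \<le> stirling_rem (Suc n) - 1 / (12 * real (Suc n) + 1)" for n
    using stirling_rem_diff_lower[of "Suc n"] by linarith
qed

lemma stirling_rem_tendsto: "stirling_rem \<longlonglongrightarrow> ln (2 * pi) / 2"
proof -
  let ?u = "\<lambda>n. stirling_rem (Suc n) - 1 / (12 * real (Suc n))"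
  have z: "(\<lambda>n. 1 / (12 * real (Suc n))) \<longlonglongrightarrow> 0"
    using tendsto_mult_right[OF LIMSEQ_inverse_real_of_nat, of "1/12"] by (simp add: field_simps)
  \<comment> \<open>The increasing sequence stays below the decreasing one, hence below the latter's
    first term; this gives convergence.\<close>
  have "?u n \<le> stirling_rem 1 - 1 / 13" for n
  proof -
    have "?u n \<le> stirling_rem (Suc n) - 1 / (12 * real (Suc n) + 1)"
      by (simp add: field_simps)
    also have "\<dots> \<le> stirling_rem 1 - 1 / 13"
      using decseqD[OF stirling_rem_minus_decseq, of 0 n] by simp
    finally show ?thesis .
  qed
  then obtain L where "?u \<longlonglongrightarrow> L"
    using incseq_convergent[OF stirling_rem_minus_incseq] by blast
  from tendsto_add[OF this z] have "(\<lambda>n. stirling_rem (Suc n)) \<longlonglongrightarrow> L" by simp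
  then have L: "stirling_rem \<longlonglongrightarrow> L" by (simp only: filterlim_sequentially_Suc)
  have L2: "(\<lambda>n. stirling_rem (2 * n)) \<longlonglongrightarrow> L"
    using LIMSEQ_subseq_LIMSEQ[OF L, of "\<lambda>n. 2 * n"] by (simp add: strict_mono_def o_def)
  have "(\<lambda>n. 4 * stirling_rem n - 2 * stirling_rem (2 * n) - ln 2 - ln (2 + 1 / real n))
      \<longlonglongrightarrow> 4 * L - 2 * L - ln 2 - ln (2 + 0)"
    by (intro tendsto_intros L L2 lim_1_over_n) simp
  moreover have "(\<lambda>n. ln (\<Prod>k=1..n. (4 * real k ^ 2) / (4 * real k ^ 2 - 1))) \<longlonglongrightarrow> ln (pi / 2)"
    by (intro tendsto_ln wallis) simp
  then have "(\<lambda>n. 4 * stirling_rem n - 2 * stirling_rem (2 * n) - ln 2 - ln (2 + 1 / real n))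
      \<longlonglongrightarrow> ln (pi / 2)"
    by (rule Lim_transform_eventually)
      (use ln_wallis_prod in \<open>auto intro!: eventually_mono[OF eventually_gt_at_top[of 0]]\<close>)
  \<comment> \<open>Wallis' product thus fixes the constant: 2 L = ln (pi/2) + 2 ln 2.\<close>
  ultimately have "4 * L - 2 * L - ln 2 - ln (2 + 0) = ln (pi / 2)"
    by (rule LIMSEQ_unique)
  then have "L = ln (2 * pi) / 2"
    by (simp add: ln_mult ln_div)
  with L show ?thesis by simp
qed

lemma stirling_rem_upper:
  assumes "0 < n"
  shows "stirling_rem n \<le> ln (2 * pi) / 2 + 1 / (12 * real n)"
proof -
  have "(\<lambda>n. stirling_rem (Suc n) - 1 / (12 * real (Suc n))) \<longlonglongrightarrow> ln (2 * pi) / 2 - 0"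
    using tendsto_mult_right[OF LIMSEQ_inverse_real_of_nat, of "1/12"]
    by (intro tendsto_diff LIMSEQ_Suc[OF stirling_rem_tendsto]) (simp add: field_simps)
  from incseq_le[OF stirling_rem_minus_incseq this, of "n - 1"] show ?thesis
    using assms by simp
qed

lemma stirling_rem_lower:
  assumes "0 < n"
  shows "ln (2 * pi) / 2 + 1 / (12 * real n + 1) \<le> stirling_rem n"
proof -
  have "(\<lambda>n. 1 / (12 * real n + 1)) \<longlonglongrightarrow> 0"
    by (rule tendsto_sandwich[OF _ _ tendsto_const lim_1_over_n])
      (auto simp: field_simps intro!: eventually_mono[OF eventually_gt_at_top[of 0]])
  then have "(\<lambda>n. stirling_rem (Suc n) - 1 / (12 * real (Suc n) + 1)) \<longlonglongrightarrow> ln (2 * pi) / 2 - 0"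
    by (intro tendsto_diff LIMSEQ_Suc[OF stirling_rem_tendsto] LIMSEQ_Suc)
  from decseq_ge[OF stirling_rem_minus_decseq this, of "n - 1"] show ?thesis
    using assms by simp
qed

section \<open>The binomial coefficient relative to M\<close>

definition ln_binomial_ratio :: "nat \<Rightarrow> nat \<Rightarrow> real" where
  "ln_binomial_ratio n k = ln (real (n choose k)) + real k * ln (real k)
     + real (n - k) * ln (real (n - k)) - (real n - 1 / 2) * ln (real n)"

lemma ln_binomial:
  assumes "k \<le> n"
  shows "ln (real (n choose k)) = ln (fact n) - ln (fact k) - ln (fact (n - k))"
  using assms by (simp add: binomial_fact ln_div ln_mult)

text \<open>The remainder of n is bounded from above, those of k and n - k from below; one copy of -
  ln (2 pi) / 2 survives and joins the logarithm.\<close>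

lemma ln_binomial_ratio_le_robbins:
  assumes "0 < k" "k < n"
  shows "ln_binomial_ratio n k \<le> ln (real n ^ 2 / (2 * pi * real k * real (n - k))) / 2
    - (1 / (12 * real k + 1) + 1 / (12 * real (n - k) + 1) - 1 / (12 * real n))"
proof -
  have "ln (real n ^ 2 / (2 * pi * real k * real (n - k)))
      = 2 * ln (real n) - ln (2 * pi) - ln (real k) - ln (real (n - k))"
    using assms by (simp add: ln_div ln_mult ln_realpow)
  moreover have "ln_binomial_ratio n k = stirling_rem n - stirling_rem k - stirling_rem (n - k)
      + ln (real n) - ln (real k) / 2 - ln (real (n - k)) / 2"
    unfolding ln_binomial_ratio_def stirling_rem_def using assms
    by (simp add: ln_binomial of_nat_diff) (simp add: algebra_simps)
  ultimately show ?thesis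
    using stirling_rem_upper[of n] stirling_rem_lower[of k] stirling_rem_lower[of "n - k"] assms
    by (simp add: add_divide_distrib diff_divide_distrib)
qed

lemma ln_binomial_ratio_Suc:
  assumes "80 \<le> k" "2 * Suc k \<le> n"
  shows "ln_binomial_ratio n (Suc k) + 11 / (12 * real n ^ 2) \<le> ln_binomial_ratio n k"
proof -
  define m where "m = n - Suc k"
  define x where "x = real k"
  define y where "y = real m"
  have xy: "80 \<le> x" "x + 1 \<le> y" and n: "real n = x + y + 1"
    using assms by (auto simp: x_def y_def m_def of_nat_diff)
  have nk: "n - k = Suc m" using assms by (simp add: m_def)
  have "ln_binomial_ratio n k - ln_binomial_ratio n (Suc k)
      = y * (ln (y + 1) - ln y) - x * (ln (x + 1) - ln x)"
  proof -
    have "ln (fact (Suc k) :: real) = ln (x + 1) + ln (fact k)"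
      "ln (fact (Suc m) :: real) = ln (y + 1) + ln (fact m)"
      unfolding fact_Suc x_def y_def by (subst ln_mult; simp add: add.commute)+
    then show ?thesis
      using assms nk unfolding ln_binomial_ratio_def
      by (simp add: ln_binomial flip: m_def)
        (simp add: x_def y_def algebra_simps)
  qed
  also have "\<dots> = y * ln (1 + 1 / y) - x * ln (1 + 1 / x)"
  proof -
    have "1 + 1 / y = (y + 1) / y" "1 + 1 / x = (x + 1) / x"
      using xy by (simp_all add: field_simps)
    then show ?thesis using xy by (simp add: ln_div)
  qed
  also have "\<dots> \<ge> 11 / (12 * real n ^ 2)"
  proof -
    have "2 / (2 * y + 1) \<le> ln (1 + 1 / y)"
      using ln_one_plus_inverse_lower[of y] xy
      by (smt (verit) divide_nonneg_nonneg zero_le_power)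
    then have "y * (2 / (2 * y + 1)) \<le> y * ln (1 + 1 / y)"
      using xy by (intro mult_left_mono) auto
    moreover have "y * (2 / (2 * y + 1)) = 1 - 1 / (2 * y + 1)"
      using xy by (simp add: field_simps)
    moreover have "1 / (2 * y + 1) \<le> 1 / (2 * x + 3)"
      using xy by (intro divide_left_mono) auto
    moreover have "x * ln (1 + 1 / x)
        \<le> x * (2 / (2 * x + 1) + 1 / (6 * x * (x + 1) * (2 * x + 1)))"
      using ln_one_plus_inverse_upper[of x] xy by (intro mult_left_mono) auto
    moreover have "x * (2 / (2 * x + 1) + 1 / (6 * x * (x + 1) * (2 * x + 1)))
        = 1 - 1 / (2 * x + 1) + 1 / (6 * (x + 1) * (2 * x + 1))"
      using xy by (simp add: divide_simps)
    moreover have "11 / (12 * real n ^ 2) \<le> 11 / (12 * (2 * (x + 1)) ^ 2)"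
      using xy n by (intro divide_left_mono mult_left_mono power_mono) auto
    \<comment> \<open>In units of 1/x^2, the gap 1/(2x+1) - 1/(2x+3) is asymptotically 1/2, while
      the first two terms are 11/48 and 1/12.\<close>
    moreover have "11 / (12 * (2 * (x + 1)) ^ 2) + 1 / (6 * (x + 1) * (2 * x + 1)) + 1 / (2 * x + 3)
        \<le> 1 / (2 * x + 1)"
    proof -
      define z where "z = x - 80"
      have "x = z + 80" "0 \<le> z" using xy by (auto simp: z_def)
      then show ?thesis
        by (simp add: divide_simps) (simp add: power2_eq_square algebra_simps)
    qed
    ultimately show ?thesis by linarith
  qed
  finally show ?thesis by simp
qed

text \<open>
  With \<open>\<delta> = 1/K + 1/M - 1/N = P / (K M N)\<close> this is \<open>n\<^sup>2 < c k m (1 + 2 \<delta> + 2 \<delta>\<^sup>2)\<close> cleared of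
  denominators, where \<open>c\<close> is a lower approximation of \<open>2 \<pi>\<close>. After expansion in \<open>z\<close> all coefficients
  of the difference are positive.
\<close>

lemma robbins_poly_ineq:
  fixes z r :: real
  assumes "0 \<le> z" "r \<in> {0, 1, 2, 3, 4}"
    and k: "k = z + 80" and m: "m = 4 * k + r" and n: "n = 5 * k + r"
    and K: "K = 12 * k + 1" and M: "M = 12 * m + 1" and N: "N = 12 * n"
    and P: "P = M * N + K * N - K * M"
  shows "n ^ 2 * (K * M * N) ^ 2
    < 6.2831853 * k * m * ((K * M * N) ^ 2 + 2 * P * (K * M * N) + 2 * P ^ 2)"
proof -
  \<comment> \<open>Both sides have degree 8 in z. The monomials are nested to the right to match
    the simplified goal, so that \<open>linarith\<close> can treat them as atoms.\<close>
  have z_pow: "0 \<le> z" "0 \<le> z * z" "0 \<le> z * (z * z)" "0 \<le> z * (z * (z * z))"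
    "0 \<le> z * (z * (z * (z * z)))" "0 \<le> z * (z * (z * (z * (z * z))))" "0 \<le> z * (z * (z * (z * (z * (z * z)))))"
    "0 \<le> z * (z * (z * (z * (z * (z * (z * z))))))"
    using assms(1) by simp_all
  have numeral_left: "z * numeral w = numeral w * z" "z * (numeral w * y) = numeral w * (z * y)"
    for w and y :: real by simp_all
  show ?thesis
    using assms(2) unfolding P K M N m n k
    by (elim insertE emptyE; simp add: algebra_simps power2_eq_square;
        simp only: numeral_left add_divide_distrib)
      (use z_pow in linarith)+
qed

text \<open>With m = n - k, Robbins' bound reduces the claim to n^2 / (2 pi k m) < exp (2 \<delta>).
  The exponential is replaced by its quadratic Taylor polynomial; at n = 404 the linear one would be
  too small.\<close>

lemma ln_binomial_ratio_fifth_neg: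
  assumes "400 \<le> n"
  shows "ln_binomial_ratio n (n div 5) < 0"
proof -
  define k m where "k = n div 5" and "m = n - k"
  define r where "r = real (n mod 5)"
  define K M N where "K = 12 * real k + 1" and "M = 12 * real m + 1" and "N = 12 * real n"
  define P where "P = M * N + K * N - K * M"
  define \<delta> where "\<delta> = 1 / K + 1 / M - 1 / N"
  have k: "80 \<le> k" "k < n" using assms by (auto simp: k_def)
  have n: "n = 5 * k + n mod 5" by (simp add: k_def)
  have mr: "real m = 4 * real k + r" and nr: "real n = 5 * real k + r"
    using n k by (auto simp: m_def r_def of_nat_diff)
  have r: "r \<in> {0, 1, 2, 3, 4}"
  proof -
    have "n mod 5 \<in> {0, 1, 2, 3, 4}" by auto
    then show ?thesis by (auto simp: r_def)
  qed
  have pos: "0 < K" "0 < M" "0 < N" "0 < real k" "0 < real m" "0 < real n"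
    using k by (auto simp: K_def M_def N_def m_def)
  have \<delta>: "\<delta> = P / (K * M * N)"
    using pos by (simp add: \<delta>_def P_def field_simps)
  have "K \<le> N" using k by (simp add: K_def N_def)
  then have "1 / N \<le> 1 / K" using pos by (simp add: frac_le)
  then have \<delta>0: "0 \<le> \<delta>" using pos by (simp add: \<delta>_def add_increasing2)
  have "real n ^ 2 * (K * M * N) ^ 2
      < 6.2831853 * real k * real m * ((K * M * N) ^ 2 + 2 * P * (K * M * N) + 2 * P ^ 2)"
    by (rule robbins_poly_ineq[of "real k - 80" r, OF _ r _ mr nr K_def M_def N_def P_def])
      (use k in auto)
  also have "\<dots> = 6.2831853 * real k * real m * (1 + 2 * \<delta> + 2 * \<delta> ^ 2) * (K * M * N) ^ 2"
    using pos by (simp add: \<delta> power_divide) (simp add: field_simps power2_eq_square)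
  finally have "real n ^ 2 < 6.2831853 * real k * real m * (1 + 2 * \<delta> + 2 * \<delta> ^ 2)"
    using pos by (simp add: mult_less_cancel_right)
  also have "\<dots> \<le> 2 * pi * real k * real m * (1 + 2 * \<delta> + 2 * \<delta> ^ 2)"
    using pi_approx(1) pos \<delta>0 by (intro mult_right_mono) auto
  also have "\<dots> \<le> 2 * pi * real k * real m * exp (2 * \<delta>)"
    using exp_lower_Taylor_quadratic[of "2 * \<delta>"] \<delta>0 pos
    by (intro mult_left_mono) (auto simp: power_mult_distrib)
  finally have "real n ^ 2 / (2 * pi * real k * real m) < exp (2 * \<delta>)"
    using pos by (simp add: field_simps)
  then have "ln (real n ^ 2 / (2 * pi * real k * real m)) < ln (exp (2 * \<delta>))"
    using pos by (subst ln_less_cancel_iff) auto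
  then have "ln (real n ^ 2 / (2 * pi * real k * real m)) / 2 - \<delta> < 0" by simp
  moreover have "ln_binomial_ratio n k \<le> ln (real n ^ 2 / (2 * pi * real k * real m)) / 2 - \<delta>"
    using ln_binomial_ratio_le_robbins[of k n] k
    by (simp add: \<delta>_def K_def M_def N_def m_def)
  ultimately show ?thesis by (simp add: k_def)
qed

text \<open>Induction upwards from \<open>n div 5\<close>: each step lowers the ratio by at least
  the amount by which the linear term grows.\<close>

lemma ln_binomial_ratio_neg:
  assumes "400 \<le> n" "n div 5 \<le> k" "2 * k \<le> n"
  shows "ln_binomial_ratio n k + (real k - real (n div 5)) * (11 / (12 * real n ^ 2)) < 0"
  using assms(2,3)
proof (induction k rule: dec_induct)
  case base
  show ?case using ln_binomial_ratio_fifth_neg[OF assms(1)] by simp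
next
  case (step k)
  have "80 \<le> k" using step assms(1) by simp
  from ln_binomial_ratio_Suc[OF this step.prems]
  have "ln_binomial_ratio n (Suc k) + 11 / (12 * real n ^ 2) \<le> ln_binomial_ratio n k" .
  moreover have "ln_binomial_ratio n k + (real k - real (n div 5)) * (11 / (12 * real n ^ 2)) < 0"
    using step by simp
  moreover have "(real (Suc k) - real (n div 5)) * c = (real k - real (n div 5)) * c + c" for c :: real
    by (simp add: algebra_simps)
  ultimately show ?case by smt
qed

section \<open>The entropy bound and the chain of inequalities\<close>

text \<open>Divided by a + b, this says that binary entropy is at most ln 2. It follows from ln u
  \<le> u - 1 at u = (a+b)/(2a) and u = (a+b)/(2b), with equality only for u = 1.\<close>

lemma entropy_bound:
  fixes a b :: real
  assumes "0 < a" "0 < b"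
  shows "(a + b) * ln (a + b) - a * ln a - b * ln b \<le> (a + b) * ln 2"
    and "a \<noteq> b \<Longrightarrow> (a + b) * ln (a + b) - a * ln a - b * ln b < (a + b) * ln 2"
proof -
  have e: "x * ln ((a + b) / (2 * x)) = x * (ln (a + b) - ln 2 - ln x)" if "0 < x" for x
    using that assms by (simp add: ln_div ln_mult)
  have le: "x * ln ((a + b) / (2 * x)) \<le> (a + b) / 2 - x" if "0 < x" for x
  proof -
    have "x * ln ((a + b) / (2 * x)) \<le> x * ((a + b) / (2 * x) - 1)"
      using that assms by (intro mult_left_mono ln_le_minus_one) auto
    also have "\<dots> = (a + b) / 2 - x" using that by (simp add: field_simps)
    finally show ?thesis .
  qed
  \<comment> \<open>The right sides of the two instances of \<open>le\<close> add up to 0.\<close>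
  show "(a + b) * ln (a + b) - a * ln a - b * ln b \<le> (a + b) * ln 2"
    using le[OF assms(1)] le[OF assms(2)] unfolding e[OF assms(1)] e[OF assms(2)]
    by (simp add: algebra_simps)
  assume "a \<noteq> b"
  have "a * ln ((a + b) / (2 * a)) \<noteq> (a + b) / 2 - a"
  proof
    assume "a * ln ((a + b) / (2 * a)) = (a + b) / 2 - a"
    then have "ln ((a + b) / (2 * a)) = (a + b) / (2 * a) - 1"
      using assms by (simp add: field_simps)
    then have "(a + b) / (2 * a) = 1" using assms by (intro ln_eq_minus_one) auto
    with \<open>a \<noteq> b\<close> assms show False by (simp add: field_simps)
  qed
  with le[of a] assms have "a * ln ((a + b) / (2 * a)) < (a + b) / 2 - a" by simp
  then show "(a + b) * ln (a + b) - a * ln a - b * ln b < (a + b) * ln 2"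
    using le[OF assms(2)] unfolding e[OF assms(1)] e[OF assms(2)]
    by (simp add: algebra_simps)
qed

text \<open>At k = floor(n/5) one has d = 0 and thus A = B; at 2 k = n one has M = 2^n / sqrt n and
  thus B = C. Hence these two inequalities are weak in general and strict away from those values of
  k.\<close>

theorem theorem2p4:
  fixes k n :: nat
  assumes "k > 0" and "n \<ge> 400"
    and "\<lfloor>real n / 5\<rfloor> \<le> int k" and "int k \<le> \<lfloor>real n / 2\<rfloor>"
  shows "let d = real k - real_of_int \<lfloor>real n / 5\<rfloor>;
             M = real n powr (real n - 1/2) / (real k ^ k * real (n - k) ^ (n - k));
             A = exp (- d * (11 / (12 * real n ^ 2))) * M;
             B = (1 - 5 * d / (6 * real n ^ 2)) * M;
             C = (1 - 5 * d / (6 * real n ^ 2)) * (2 ^ n / sqrt (real n))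
         in real (n choose k) < A \<and> A \<le> B \<and> B \<le> C \<and>
            (\<lfloor>real n / 5\<rfloor> \<noteq> int k \<longrightarrow> A < B) \<and>
            (2 * k \<noteq> n \<longrightarrow> B < C)"
proof -
  have fl: "\<lfloor>real n / 5\<rfloor> = int (n div 5)" "\<lfloor>real n / 2\<rfloor> = int (n div 2)"
    using floor_divide_of_nat_eq[of n 5] floor_divide_of_nat_eq[of n 2] by simp_all
  have k: "n div 5 \<le> k" "2 * k \<le> n" "k < n" using assms by (auto simp: fl)
  define d where "d = real k - real (n div 5)"
  define M where "M = real n powr (real n - 1/2) / (real k ^ k * real (n - k) ^ (n - k))"
  define t where "t = d / real n ^ 2"
  have pos: "0 < real k" "0 < real (n - k)" "0 < real n" using assms(1) k by auto
  have d0: "0 \<le> d" "d \<le> real n" using k by (auto simp: d_def)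
  have M0: "0 < M" using pos by (simp add: M_def)
  have lnM: "ln M = (real n - 1 / 2) * ln (real n) - real k * ln (real k)
      - real (n - k) * ln (real (n - k))"
    using pos by (simp add: M_def ln_div ln_mult ln_powr ln_realpow)
  have "ln (real (n choose k)) < - d * (11 / (12 * real n ^ 2)) + ln M"
    using ln_binomial_ratio_neg[OF assms(2) k(1,2)]
    unfolding ln_binomial_ratio_def lnM d_def by linarith
  also have "\<dots> = ln (exp (- d * (11 / (12 * real n ^ 2))) * M)"
    using M0 by (simp add: ln_mult)
  finally have A: "real (n choose k) < exp (- d * (11 / (12 * real n ^ 2))) * M"
    using k M0 by (subst (asm) ln_less_cancel_iff) auto
  have "t \<le> real n / real n ^ 2"
    unfolding t_def using d0 by (intro divide_right_mono) auto
  also have "\<dots> = 1 / real n" by (simp add: power2_eq_square)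
  also have "\<dots> \<le> 1 / 400" using assms(2) by (intro divide_left_mono) auto
  finally have t: "0 \<le> t" "t \<le> 1 / 400" using d0 by (auto simp: t_def)
  have t_pos: "0 < t" if "n div 5 \<noteq> k" using that k pos by (simp add: t_def d_def)
  have e5: "1 - 5 * d / (6 * real n ^ 2) = 1 - 5 / 6 * t" and
    e11: "- d * (11 / (12 * real n ^ 2)) = - (11 / 12 * t)"
    by (simp_all add: t_def)
  \<comment> \<open>As 11/12 exceeds 5/6 by 1/12, the product (1 - 5t/6) (1 + 11t/12) is above 1 for
    0 < t < 6/55, which t \<le> 1/400 ensures.\<close>
  have exp_lt: "exp (- (11 / 12 * t)) < 1 - 5 / 6 * t" if "0 < t"
  proof -
    have "(1 - 5 / 6 * t) * (1 + 11 / 12 * t) = 1 + t * (1 / 12 - 55 / 72 * t)"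
      by (simp add: field_simps)
    also have "\<dots> > 1" using that t by simp
    finally have "1 < (1 - 5 / 6 * t) * (1 + 11 / 12 * t)" .
    also have "\<dots> \<le> (1 - 5 / 6 * t) * exp (11 / 12 * t)"
      using t by (intro mult_left_mono exp_ge_add_one_self) auto
    finally show ?thesis by (simp add: exp_minus field_simps)
  qed
  have AB: "exp (- d * (11 / (12 * real n ^ 2))) * M < (1 - 5 * d / (6 * real n ^ 2)) * M"
    if "n div 5 \<noteq> k"
    unfolding e5 e11 using exp_lt[OF t_pos[OF that]] M0 by (intro mult_strict_right_mono)
  then have AB': "exp (- d * (11 / (12 * real n ^ 2))) * M \<le> (1 - 5 * d / (6 * real n ^ 2)) * M"
    by (cases "n div 5 = k") (auto simp: d_def)
  have C0: "0 < (2::real) ^ n / sqrt (real n)" using pos by simp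
  have lnC: "ln (2 ^ n / sqrt (real n)) = real n * ln 2 - ln (real n) / 2"
    using pos by (simp add: ln_div ln_realpow ln_sqrt)
  have nk: "real k + real (n - k) = real n" using k by simp
  \<comment> \<open>The term - ln n / 2 occurs on both sides; what remains is the entropy bound with
    a = k and b = n - k.\<close>
  have "ln M \<le> ln (2 ^ n / sqrt (real n))"
    using entropy_bound(1)[OF pos(1,2)] unfolding nk lnM lnC by (simp add: algebra_simps)
  then have "M \<le> 2 ^ n / sqrt (real n)" using M0 C0 by (subst (asm) ln_le_cancel_iff)
  then have BC': "(1 - 5 * d / (6 * real n ^ 2)) * M
      \<le> (1 - 5 * d / (6 * real n ^ 2)) * (2 ^ n / sqrt (real n))"
    unfolding e5 using t by (intro mult_left_mono) auto
  have BC: "(1 - 5 * d / (6 * real n ^ 2)) * M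
      < (1 - 5 * d / (6 * real n ^ 2)) * (2 ^ n / sqrt (real n))" if "2 * k \<noteq> n"
  proof -
    have "real k \<noteq> real (n - k)" using that k by auto
    from entropy_bound(2)[OF pos(1,2) this] have "ln M < ln (2 ^ n / sqrt (real n))"
      unfolding nk lnM lnC by (simp add: algebra_simps)
    then have "M < 2 ^ n / sqrt (real n)" using M0 C0 by (subst (asm) ln_less_cancel_iff)
    then show ?thesis unfolding e5 using t by (intro mult_strict_left_mono) auto
  qed
  have "d = real k - real_of_int \<lfloor>real n / 5\<rfloor>" by (simp add: d_def fl)
  then show ?thesis
    using A AB AB' BC BC' unfolding Let_def M_def[symmetric] by (simp add: fl)
qed

end
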